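(* Let $M$ be a random $n\times n$ matrix whose entries are i.i.d. with continuous cumulative distribution function $G$, let $Q=(M+M^T)/2$, and let $K_n$ be the support size of a global minimizer $\mathbf X^*$ of $\mathbf x^TQ\mathbf x$ over the standard simplex $\Delta_n$. Suppose that for some real $a$ and positive $b,c,\kappa$, $$G(x)=(c+O(|x|^{-\kappa}))\,|x|^a\exp(-|x|^b),\qquad x\to-\infty,$$ and that this asymptotic formula can be differentiated to yield an asymptotic formula for the density $g=G'$, namely $g(x)=(cb+O(|x|^{-\kappa}))|x|^{a+b-1}\exp(-|x|^b)$ as $x\to-\infty$. Let $b\le1$ and $a>-1$. Let $$a'=\begin{cases}a+b-1,& 0<b<1,\\ 2a+1,& b=1,\end{cases}\qquad \sigma>\sigma(a',b):=\begin{cases}1+\dfrac{|a'|+1}{b},& a'\le0,\\[2mm] 1+\dfrac{2a'+1}{b},& a'>0.\end{cases}$$ Then, for all $k$ between $\lfloor\log^{\sigma}n\rfloor$ and $k_n=\lceil\alpha n^{1/2}\rceil$ ($\alpha>e\sqrt2$), we have $$\Pr\{K_n=k+1\}\le\exp\bigl(-\log^{1+d'}n\bigr),\qquad\forall\, d'<\frac{b(\sigma-\sigma(a',b))}{2}.$$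
   Context: $\Delta_n=\{\mathbf x\in\mathbb R^n:\ \mathbf x\ge \mathbf 0,\ \sum_{j}x_j=1\}$. $\mathbf X^*$ denotes a global minimum solution of the problem of minimizing $\mathbf x^TQ\mathbf x$ over $\Delta_n$, and $K_n=|\{j\in[n]: X^*_j>0\}|$. $\log^{s}n$ means $(\log n)^s$. The statement is asymptotic: for fixed $\alpha,\sigma,d'$ the bound holds for all sufficiently large $n$, for all $k$ in the stated range. *)

theory Defs
  imports "HOL-Probability.Probability"
begin

text \<open>
  Since the dimension \<open>n\<close> tends to infinity, vectors and matrices are functions on natural
  numbers of which only the entries with indices below \<open>n\<close> are ever used.
\<close>

definition std_simplex :: "nat \<Rightarrow> (nat \<Rightarrow> real) set" where
  "std_simplex n = {x. (\<forall>j<n. 0 \<le> x j) \<and> (\<Sum>j<n. x j) = 1}"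

definition sym_part :: "(nat \<Rightarrow> nat \<Rightarrow> real) \<Rightarrow> nat \<Rightarrow> nat \<Rightarrow> real" where
  "sym_part A i j = (A i j + A j i) / 2"

definition quad_form :: "nat \<Rightarrow> (nat \<Rightarrow> nat \<Rightarrow> real) \<Rightarrow> (nat \<Rightarrow> real) \<Rightarrow> real" where
  "quad_form n Q x = (\<Sum>i<n. \<Sum>j<n. x i * Q i j * x j)"

definition StQP_solution :: "nat \<Rightarrow> (nat \<Rightarrow> nat \<Rightarrow> real) \<Rightarrow> (nat \<Rightarrow> real) \<Rightarrow> bool" where
  "StQP_solution n Q x \<longleftrightarrow> is_arg_min (quad_form n Q) (\<lambda>y. y \<in> std_simplex n) x"

definition support_size :: "nat \<Rightarrow> (nat \<Rightarrow> real) \<Rightarrow> nat" where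
  "support_size n x = card {j. j < n \<and> x j > 0}"

definition iid_matrix ::
  "'w measure \<Rightarrow> nat \<Rightarrow> (real \<Rightarrow> real) \<Rightarrow> ('w \<Rightarrow> nat \<Rightarrow> nat \<Rightarrow> real) \<Rightarrow> bool" where
  "iid_matrix P n G M \<longleftrightarrow>
     prob_space.indep_vars P (\<lambda>_. borel) (\<lambda>(i, j) \<omega>. M \<omega> i j) ({..<n} \<times> {..<n}) \<and>
     (\<forall>i<n. \<forall>j<n. cdf (distr P borel (\<lambda>\<omega>. M \<omega> i j)) = G)"

text \<open>
  A random vector selecting, at each outcome, some global minimizer; no uniqueness of the
  minimizer is presupposed.
\<close>

definition random_StQP_solution ::
  "'w measure \<Rightarrow> nat \<Rightarrow> ('w \<Rightarrow> nat \<Rightarrow> nat \<Rightarrow> real) \<Rightarrow> ('w \<Rightarrow> nat \<Rightarrow> real) \<Rightarrow> bool" where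
  "random_StQP_solution P n Q X \<longleftrightarrow>
     (\<forall>j<n. (\<lambda>\<omega>. X \<omega> j) \<in> borel_measurable P) \<and>
     (\<forall>\<omega>\<in>space P. StQP_solution n (Q \<omega>) (X \<omega>))"

text \<open>Only meant for \<open>0 < b \<le> 1\<close>: the second branch is the case \<open>b = 1\<close>.\<close>

definition a_prime :: "real \<Rightarrow> real \<Rightarrow> real" where
  "a_prime a b = (if b < 1 then a + b - 1 else 2 * a + 1)"

definition sigma_crit :: "real \<Rightarrow> real \<Rightarrow> real" where
  "sigma_crit a' b = (if a' \<le> 0 then 1 + (\<bar>a'\<bar> + 1) / b else 1 + (2 * a' + 1) / b)"

end

theory Submission imports Defs "HOL-Real_Asymp.Real_Asymp" begin

text \<open>
  Write \<open>L = (ln n) powr (1 / b)\<close> and let \<open>x\<close> be a minimizer with value \<open>l\<close> and support \<open>S\<close>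
  of size \<open>k + 1\<close>. The bound rests on two competing facts.

  On the one hand, \<open>l\<close> is at most every diagonal entry, since the vertices of the simplex are
  feasible, and the least of the \<open>n\<close> diagonal entries is about \<open>- L\<close>. The first order condition
  says that \<open>(Q x)\<^sub>i \<le> l\<close> for \<open>i \<in> S\<close>. Adding these inequalities over \<open>S\<close> gives
  \<open>(\<Sum>j\<in>S. x\<^sub>j * (\<Sum>i\<in>S. Q\<^sub>i\<^sub>j)) \<le> (k + 1) * l\<close>, and as the weights \<open>x\<^sub>j\<close> add up to 1, some
  column \<open>j \<in> S\<close> has an unweighted sum of at most \<open>(k + 1) * l\<close>. So \<open>k\<close> off-diagonal
  entries of one column average at most about \<open>- L\<close> (lemma \<open>StQP_solution_light_column\<close>).

  On the other hand, an off-diagonal entry is the mean of two independent variables with tail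
  \<open>exp (- \<bar>x\<bar> powr b)\<close>. Because \<open>b \<le> 1\<close>, \<open>t \<mapsto> t powr b\<close> is subadditive, so the lower tail of that mean
  at \<open>- t\<close> is about \<open>exp (- (2 * t) powr b)\<close>, and the entries of a typical column are hardly
  ever lower than \<open>- L / 2\<close>. The part of the column sum beyond a threshold between \<open>L / 2\<close> and \<open>L\<close> (here
  \<open>3 * L / 5\<close>) therefore has to come from exceptional entries. Their total is at least a fixed
  multiple of \<open>k * L\<close>, and by subadditivity their \<open>b\<close>-th powers add up to at least a fixed multiple of
  \<open>k powr b * ln n\<close> (lemma \<open>sum_large_powr_ge\<close>). Beyond the threshold, an exponential moment of such
  a \<open>b\<close>-th power is only \<open>O(1 / n)\<close>, so the expected product over the \<open>n - 1\<close> entries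
  of a column stays bounded, and Markov's inequality bounds the probability by a multiple of
  \<open>exp (- \<theta> * k powr b * ln n)\<close> (lemma \<open>prob_column_prod_ge\<close>). All entries of the column are
  included in the sum, so the choice of \<open>S\<close> costs nothing; only the union over the \<open>n\<close>
  columns does.

  For \<open>k \<ge> \<lfloor>(ln n) powr \<sigma>\<rfloor>\<close> this is at most \<open>exp (- c * (ln n) powr (1 + \<sigma> * b))\<close>, and \<open>\<sigma> * b\<close> exceeds
  \<open>d'\<close> because the critical exponent is at least 1; here \<open>c > 0\<close> is a constant. The event that all diagonal entries exceed
  \<open>- 4 * L / 5\<close> has a much smaller probability, at most \<open>exp (- n powr \<delta>)\<close>
  for some \<open>\<delta> > 0\<close>.
\<close>

section \<open>Subadditivity of powers and sums of large terms\<close>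

text \<open>
  The shares \<open>u / (u + v)\<close> and \<open>v / (u + v)\<close> lie in the unit interval, where raising to a power
  \<open>b \<le> 1\<close> can only increase a number.
\<close>

lemma powr_add_le_add_powr:
  fixes u v b :: real
  assumes "0 \<le> u" "0 \<le> v" "0 < b" "b \<le> 1"
  shows "(u + v) powr b \<le> u powr b + v powr b"
proof (cases "u + v = 0")
  case False
  then have s: "u + v > 0" using assms by simp
  have le: "p \<le> p powr b" if "0 \<le> p" "p \<le> 1" for p :: real
    using powr_mono'[of b 1 p] that assms by simp
  have "1 = u / (u + v) + v / (u + v)"
    using s by (simp add: add_divide_distrib[symmetric])
  also have "\<dots> \<le> (u / (u + v)) powr b + (v / (u + v)) powr b"
    using assms s by (intro add_mono le) auto
  also have "\<dots> = (u powr b + v powr b) / (u + v) powr b"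
    using assms s by (simp add: powr_divide add_divide_distrib)
  finally show ?thesis using s by (simp add: field_simps)
qed (use assms in auto)

lemma powr_sum_le_sum_powr:
  fixes f :: "'i \<Rightarrow> real"
  assumes "finite I" "\<And>i. i \<in> I \<Longrightarrow> 0 \<le> f i" "0 < b" "b \<le> 1"
  shows "(\<Sum>i\<in>I. f i) powr b \<le> (\<Sum>i\<in>I. f i powr b)"
  using assms(1,2)
proof (induction rule: finite_induct)
  case (insert i I)
  then have "(f i + sum f I) powr b \<le> f i powr b + sum f I powr b"
    using assms by (intro powr_add_le_add_powr) (auto intro: sum_nonneg)
  with insert show ?case by simp
qed simp

text \<open>
  Terms up to \<open>t\<close> cannot account for more than \<open>t\<close> per index of \<open>S\<close>, so the terms above \<open>t\<close> carry
  at least \<open>card S * s\<close>. The right-hand side runs over all of \<open>I\<close>: in the application this removes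
  the dependence on the unknown set \<open>S\<close>.
\<close>

lemma sum_large_powr_ge:
  fixes v :: "'i \<Rightarrow> real"
  assumes "finite I" "S \<subseteq> I" "\<And>i. i \<in> I \<Longrightarrow> 0 \<le> v i" "0 < b" "b \<le> 1"
    and "0 \<le> t"
    and "0 \<le> s" and "real (card S) * (s + t) \<le> (\<Sum>i\<in>S. v i)"
  shows "(real (card S) * s) powr b \<le> (\<Sum>i\<in>I. if t < v i then v i powr b else 0)"
proof -
  have "(\<Sum>i\<in>S. v i) \<le> (\<Sum>i\<in>S. t + (if t < v i then v i else 0))"
    using assms by (intro sum_mono) auto
  also have "\<dots> = real (card S) * t + (\<Sum>i\<in>S. if t < v i then v i else 0)"
    by (simp add: sum.distrib)
  also have "(\<Sum>i\<in>S. if t < v i then v i else 0) \<le> (\<Sum>i\<in>I. if t < v i then v i else 0)"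
    using assms by (intro sum_mono2) auto
  finally have "real (card S) * s \<le> (\<Sum>i\<in>I. if t < v i then v i else 0)"
    using assms by (simp add: algebra_simps)
  then have "(real (card S) * s) powr b \<le> (\<Sum>i\<in>I. if t < v i then v i else 0) powr b"
    using assms by (intro powr_mono2) auto
  also have "\<dots> \<le> (\<Sum>i\<in>I. (if t < v i then v i else 0) powr b)"
    using assms by (intro powr_sum_le_sum_powr) auto
  also have "\<dots> = (\<Sum>i\<in>I. if t < v i then v i powr b else 0)"
    by (intro sum.cong) auto
  finally show ?thesis .
qed

text \<open>
  The exponential Chebyshev step for truncated variables. Lowering the exponent from \<open>\<theta>'\<close> to \<open>\<theta>\<close>
  gains the factor \<open>exp (- (\<theta>' - \<theta>) * \<tau>)\<close> on terms above \<open>\<tau>\<close>; the summand 1 covers the others.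
\<close>

lemma exp_sum_large_le_prod:
  fixes w :: "'i \<Rightarrow> real"
  assumes "finite I" "\<theta> \<le> \<theta>'" "0 \<le> \<tau>"
  shows "exp (\<theta> * (\<Sum>i\<in>I. if \<tau> < w i then w i else 0))
           \<le> (\<Prod>i\<in>I. 1 + exp (- (\<theta>' - \<theta>) * \<tau>) * exp (\<theta>' * w i))"
proof -
  have "exp (\<theta> * (if \<tau> < w i then w i else 0)) \<le> 1 + exp (- (\<theta>' - \<theta>) * \<tau>) * exp (\<theta>' * w i)" for i
  proof (cases "\<tau> < w i")
    case True
    have "(\<theta>' - \<theta>) * \<tau> \<le> (\<theta>' - \<theta>) * w i"
      using True assms by (intro mult_left_mono) auto
    then have "\<theta> * w i \<le> - (\<theta>' - \<theta>) * \<tau> + \<theta>' * w i"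
      by (simp add: algebra_simps)
    then have "exp (\<theta> * w i) \<le> exp (- (\<theta>' - \<theta>) * \<tau>) * exp (\<theta>' * w i)"
      by (simp add: exp_add[symmetric])
    with True show ?thesis by simp
  qed simp
  then show ?thesis
    using assms by (simp add: sum_distrib_left exp_sum) (intro prod_mono, auto)
qed

section \<open>First order condition at a minimizer\<close>

definition mat_vec :: "nat \<Rightarrow> (nat \<Rightarrow> nat \<Rightarrow> real) \<Rightarrow> (nat \<Rightarrow> real) \<Rightarrow> nat \<Rightarrow> real" where
  "mat_vec n Q x i = (\<Sum>j<n. Q i j * x j)"

lemma StQP_solution_le_diag:
  assumes "StQP_solution n Q x" "i < n"
  shows "quad_form n Q x \<le> Q i i"
proof -
  define y where "y = (\<lambda>j. if j = i then 1 else 0 :: real)"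
  have "y \<in> std_simplex n"
    using assms by (auto simp: std_simplex_def y_def)
  then have "quad_form n Q x \<le> quad_form n Q y"
    using assms by (auto simp: StQP_solution_def is_arg_min_linorder)
  also have "\<dots> = Q i i"
    using assms(2) by (simp add: quad_form_def y_def if_distrib[of "\<lambda>z. z * _"] if_distrib[of "(*) _"] cong: if_cong)
  finally show ?thesis .
qed

text \<open>
  The value of the form when \<open>x\<close> moves away from the vertex \<open>e\<^sub>i\<close> of the simplex, that is, to
  \<open>x + s * (x - e\<^sub>i)\<close>.
\<close>

lemma quad_form_segment:
  assumes sym: "\<And>i j. Q i j = Q j i" and "i < n"
  defines "e \<equiv> \<lambda>j. if j = i then 1 else 0 :: real"
  shows "quad_form n Q (\<lambda>j. (1 + s) * x j - s * e j)
     = (1 + s)\<^sup>2 * quad_form n Q x - 2 * s * (1 + s) * mat_vec n Q x i + s\<^sup>2 * Q i i"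
proof -
  have r1: "(\<Sum>k<n. \<Sum>j<n. x k * Q k j * e j) = mat_vec n Q x i"
    using assms(2) by (simp add: e_def mat_vec_def sym[of i] if_distrib[of "(*) _"] mult.commute cong: if_cong)
  have r2: "(\<Sum>k<n. \<Sum>j<n. e k * Q k j * x j) = mat_vec n Q x i"
    using r1 by (subst sum.swap) (simp add: sym ac_simps)
  have r3: "(\<Sum>k<n. \<Sum>j<n. e k * Q k j * e j) = Q i i"
    using assms(2) by (simp add: e_def if_distrib[of "\<lambda>z. z * _"] if_distrib[of "(*) _"] cong: if_cong)
  have "quad_form n Q (\<lambda>j. (1 + s) * x j - s * e j)
    = (\<Sum>k<n. \<Sum>j<n. (1+s)\<^sup>2 * (x k * Q k j * x j) - s * (1+s) * (x k * Q k j * e j)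
        - s * (1+s) * (e k * Q k j * x j) + s\<^sup>2 * (e k * Q k j * e j))"
    unfolding quad_form_def by (intro sum.cong refl) (simp add: algebra_simps power2_eq_square)
  also have "\<dots> = (1+s)\<^sup>2 * quad_form n Q x - s * (1+s) * mat_vec n Q x i - s * (1+s) * mat_vec n Q x i + s\<^sup>2 * Q i i"
    unfolding quad_form_def
    by (simp only: sum.distrib sum_subtractf sum_distrib_left[symmetric] r1 r2 r3)
  finally show ?thesis by (simp add: algebra_simps)
qed

text \<open>
  As \<open>x\<^sub>i > 0\<close>, the point \<open>x + s * (x - e\<^sub>i)\<close> stays in the simplex for small \<open>s > 0\<close>. The derivative of the
  form at \<open>s = 0\<close> in this direction is \<open>2 * (l - (Q x)\<^sub>i)\<close>, with \<open>l\<close> the minimum, and must not be negative.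
\<close>

lemma StQP_solution_mat_vec_le:
  assumes "StQP_solution n Q x" and sym: "\<And>i j. Q i j = Q j i" and "i < n" "0 < x i"
  shows "mat_vec n Q x i \<le> quad_form n Q x"
proof (rule ccontr)
  define q l where "q = mat_vec n Q x i" and "l = quad_form n Q x"
  assume "\<not> ?thesis"
  then have gap: "q - l > 0" by (simp add: q_def l_def)
  have x: "\<And>j. j < n \<Longrightarrow> 0 \<le> x j" "(\<Sum>j<n. x j) = 1"
    using assms(1) by (auto simp: StQP_solution_def is_arg_min_linorder std_simplex_def)
  have key: "2 * (q - l) \<le> s * \<bar>l - 2 * q + Q i i\<bar>" if s: "0 < s" "s \<le> x i" for s
  proof -
    define e where "e = (\<lambda>j. if j = i then 1 else 0 :: real)"
    have "(\<lambda>j. (1 + s) * x j - s * e j) \<in> std_simplex n"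
      unfolding std_simplex_def
    proof (intro CollectI conjI allI impI)
      fix j assume "j < n"
      show "0 \<le> (1 + s) * x j - s * e j"
      proof (cases "j = i")
        case True
        have "0 \<le> s * x i" using s assms by simp
        moreover have "(1 + s) * x j - s * e j = x i + s * x i - s"
          using True by (simp add: e_def algebra_simps)
        ultimately show ?thesis using s by linarith
      qed (use s x \<open>j < n\<close> in \<open>simp add: e_def\<close>)
    next
      have "(\<Sum>j<n. (1 + s) * x j - s * e j) = (1 + s) * (\<Sum>j<n. x j) - s * (\<Sum>j<n. e j)"
        by (simp only: sum_subtractf sum_distrib_left)
      then show "(\<Sum>j<n. (1 + s) * x j - s * e j) = 1"
        using x assms(3) by (simp add: e_def)
    qed
    then have "l \<le> quad_form n Q (\<lambda>j. (1 + s) * x j - s * e j)"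
      using assms(1) by (auto simp: StQP_solution_def is_arg_min_linorder l_def)
    also have "\<dots> = (1 + s)\<^sup>2 * l - 2 * s * (1 + s) * q + s\<^sup>2 * Q i i"
      unfolding e_def q_def l_def by (rule quad_form_segment) (use assms in auto)
    finally have "s * (2 * (q - l)) \<le> s * (s * (l - 2 * q + Q i i))"
      by (simp add: algebra_simps power2_eq_square)
    then have "2 * (q - l) \<le> s * (l - 2 * q + Q i i)"
      using s by (simp only: mult_le_cancel_left_pos)
    also have "\<dots> \<le> s * \<bar>l - 2 * q + Q i i\<bar>"
      using s by (intro mult_left_mono) auto
    finally show ?thesis .
  qed
  define s where "s = min (x i) ((q - l) / (\<bar>l - 2 * q + Q i i\<bar> + 1))"
  have s: "0 < s" "s \<le> x i" "s \<le> (q - l) / (\<bar>l - 2 * q + Q i i\<bar> + 1)"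
    using gap assms by (auto simp: s_def)
  have "s * \<bar>l - 2 * q + Q i i\<bar> \<le> s * (\<bar>l - 2 * q + Q i i\<bar> + 1)"
    using s by (intro mult_left_mono) auto
  also have "\<dots> \<le> q - l"
    using s(3) by (simp add: field_simps)
  finally show False using key[of s] s gap by simp
qed

text \<open>
  The entries \<open>(Q x)\<^sub>i\<close> with \<open>i\<close> in the support average at most the minimum \<open>l\<close>. Exchanging the sums
  turns this average into a convex combination, with weights \<open>x\<^sub>j\<close>, of the column sums over the
  support, so one of these is small. Its diagonal entry is at least \<open>l\<close> and can be taken out, which
  leaves \<open>k\<close> off-diagonal entries that average at most \<open>l\<close>.
\<close>

lemma StQP_solution_light_column:
  assumes "StQP_solution n Q x" and sym: "\<And>i j. Q i j = Q j i" and "support_size n x = k + 1"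
  obtains j S where "j < n" "S \<subseteq> {..<n} - {j}" "card S = k"
    "\<And>i. i < n \<Longrightarrow> (\<Sum>i\<in>S. Q i j) \<le> real k * Q i i"
proof -
  define T where "T = {j. j < n \<and> x j > 0}"
  define l where "l = quad_form n Q x"
  have T: "finite T" "T \<subseteq> {..<n}" "card T = k + 1"
    using assms(3) by (auto simp: T_def support_size_def)
  have x: "\<And>j. j < n \<Longrightarrow> 0 \<le> x j" "(\<Sum>j<n. x j) = 1"
    using assms(1) by (auto simp: StQP_solution_def is_arg_min_linorder std_simplex_def)
  have outside: "x j = 0" if "j \<in> {..<n} - T" for j
    using that x(1)[of j] by (auto simp: T_def)
  have xT: "(\<Sum>j\<in>T. x j) = 1"
    using sum.mono_neutral_left[of "{..<n}" T x] T x(2) outside by auto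
  have "(\<Sum>j\<in>T. x j * (\<Sum>i\<in>T. Q i j)) = (\<Sum>i\<in>T. mat_vec n Q x i)"
  proof -
    have "mat_vec n Q x i = (\<Sum>j\<in>T. Q i j * x j)" for i
      unfolding mat_vec_def using T outside by (intro sum.mono_neutral_right) auto
    then show ?thesis
      by (simp add: sum_distrib_left) (subst sum.swap, simp add: ac_simps)
  qed
  also have "\<dots> \<le> (\<Sum>i\<in>T. l)"
    unfolding l_def using StQP_solution_mat_vec_le[OF assms(1) sym] by (intro sum_mono) (auto simp: T_def)
  also have "\<dots> = (\<Sum>j\<in>T. x j * (real (k + 1) * l))"
    using T xT by (simp add: sum_distrib_right[symmetric])
  finally have le: "(\<Sum>j\<in>T. x j * (\<Sum>i\<in>T. Q i j)) \<le> (\<Sum>j\<in>T. x j * (real (k + 1) * l))" .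
  have "\<exists>j\<in>T. x j * (\<Sum>i\<in>T. Q i j) \<le> x j * (real (k + 1) * l)"
  proof (rule ccontr)
    assume neg: "\<not> ?thesis"
    have "(\<Sum>j\<in>T. x j * (real (k + 1) * l)) < (\<Sum>j\<in>T. x j * (\<Sum>i\<in>T. Q i j))"
      by (rule sum_strict_mono) (use T neg in \<open>auto simp: not_le simp del: of_nat_add\<close>)
    with le show False by simp
  qed
  then obtain j where j: "j \<in> T" "(\<Sum>i\<in>T. Q i j) \<le> real (k + 1) * l"
    by (auto simp: T_def)
  have "(\<Sum>i\<in>T - {j}. Q i j) \<le> real k * l"
  proof -
    have "l \<le> Q j j"
      using StQP_solution_le_diag[OF assms(1), of j] j by (auto simp: T_def l_def)
    moreover have "(\<Sum>i\<in>T - {j}. Q i j) = (\<Sum>i\<in>T. Q i j) - Q j j"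
      using T j by (simp add: sum_diff1)
    ultimately show ?thesis using j by (simp add: algebra_simps)
  qed
  moreover have "real k * l \<le> real k * Q i i" if "i < n" for i
    using StQP_solution_le_diag[OF assms(1) that] by (auto simp: l_def intro: mult_left_mono)
  ultimately show ?thesis
    using T j by (intro that[of j "T - {j}"]) (auto intro: order_trans)
qed

section \<open>Moments and tails of the random entries\<close>

text \<open>
  Comparison of \<open>exp (\<theta> * Y)\<close> with a geometric series by rounding \<open>Y\<close> to integers. The bound is explicit
  because it must not depend on the probability space or on the dimension.
\<close>

lemma nn_integral_exp_le_of_tail:
  fixes Y :: "'w \<Rightarrow> real"
  assumes "prob_space P" and Y [measurable]: "Y \<in> borel_measurable P"
    and pos: "\<And>\<omega>. \<omega> \<in> space P \<Longrightarrow> 0 \<le> Y \<omega>"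
    and tail: "\<And>m :: nat. measure P {\<omega> \<in> space P. real m \<le> Y \<omega>} \<le> A * exp (- \<rho> * real m)"
    and th: "0 \<le> \<theta>" "\<theta> < \<rho>"
  shows "(\<integral>\<^sup>+ \<omega>. ennreal (exp (\<theta> * Y \<omega>)) \<partial>P) \<le> ennreal (A * exp \<theta> / (1 - exp (\<theta> - \<rho>)))"
proof -
  interpret prob_space P by fact
  define E where "E = (\<lambda>m :: nat. {\<omega> \<in> space P. real m \<le> Y \<omega>})"
  have [measurable]: "E m \<in> sets P" for m unfolding E_def by measurable
  have A: "0 \<le> A" using order_trans[OF measure_nonneg tail[of 0]] by simp
  have "(\<integral>\<^sup>+ \<omega>. ennreal (exp (\<theta> * Y \<omega>)) \<partial>P)
      \<le> (\<integral>\<^sup>+ \<omega>. (\<Sum>m. ennreal (exp (\<theta> * (real m + 1))) * indicator (E m) \<omega>) \<partial>P)"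
  proof (intro nn_integral_mono)
    fix \<omega> assume \<omega>: "\<omega> \<in> space P"
    define m where "m = nat \<lfloor>Y \<omega>\<rfloor>"
    have m: "real m \<le> Y \<omega>" "Y \<omega> \<le> real m + 1"
      using pos[OF \<omega>] unfolding m_def by linarith+
    have "\<theta> * Y \<omega> \<le> \<theta> * (real m + 1)"
      using m th by (intro mult_left_mono) auto
    then have "ennreal (exp (\<theta> * Y \<omega>)) \<le> ennreal (exp (\<theta> * (real m + 1))) * indicator (E m) \<omega>"
      using \<omega> m by (simp add: E_def)
    also have "\<dots> \<le> (\<Sum>m. ennreal (exp (\<theta> * (real m + 1))) * indicator (E m) \<omega>)"
      using sum_le_suminf[of "\<lambda>m. ennreal (exp (\<theta> * (real m + 1))) * indicator (E m) \<omega>" "{m}"]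
      by (simp only: summableI finite.intros simp_thms sum.insert empty_iff sum.empty add_0_right
          zero_le not_False_eq_True)
    finally show "ennreal (exp (\<theta> * Y \<omega>)) \<le> \<dots>" .
  qed
  also have "\<dots> = (\<Sum>m. ennreal (exp (\<theta> * (real m + 1))) * emeasure P (E m))"
    by (simp add: nn_integral_suminf nn_integral_cmult_indicator)
  also have "\<dots> \<le> (\<Sum>m. ennreal (A * exp \<theta> * exp (\<theta> - \<rho>) ^ m))"
  proof (intro suminf_le summableI)
    fix m
    have "exp (\<theta> * (real m + 1)) * prob (E m) \<le> exp (\<theta> * (real m + 1)) * (A * exp (- \<rho> * real m))"
      using tail[of m] by (intro mult_left_mono) (auto simp: E_def)
    also have "\<dots> = A * exp \<theta> * exp (\<theta> - \<rho>) ^ m"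
      by (simp add: exp_of_nat_mult[symmetric] mult_exp_exp algebra_simps)
    finally show "ennreal (exp (\<theta> * (real m + 1))) * emeasure P (E m) \<le> ennreal (A * exp \<theta> * exp (\<theta> - \<rho>) ^ m)"
      by (simp add: emeasure_eq_measure ennreal_mult[symmetric] ennreal_leI)
  qed
  also have "\<dots> = ennreal (\<Sum>m. A * exp \<theta> * exp (\<theta> - \<rho>) ^ m)"
    using A th by (intro suminf_ennreal2 summable_mult summable_geometric) auto
  also have "(\<Sum>m. A * exp \<theta> * exp (\<theta> - \<rho>) ^ m) = A * exp \<theta> / (1 - exp (\<theta> - \<rho>))"
    using th by (subst suminf_mult) (auto simp: suminf_geometric intro!: summable_geometric)
  finally show ?thesis .
qed

lemma cdf_distr:
  assumes "prob_space P" "Y \<in> borel_measurable P"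
  shows "cdf (distr P borel Y) x = measure P {\<omega> \<in> space P. Y \<omega> \<le> x}"
  using assms by (simp add: cdf_def2 measure_distr vimage_def Int_def conj_commute)

text \<open>
  The tail bound is available only for arguments below \<open>- x0\<close>; the factor \<open>exp (\<rho> * x0 powr b)\<close> makes the
  trivial bound 1 serve for the remaining arguments.
\<close>

lemma nn_integral_exp_neg_part_powr_le:
  fixes Y :: "'w \<Rightarrow> real"
  assumes "prob_space P" and Y [measurable]: "Y \<in> borel_measurable P"
    and G: "cdf (distr P borel Y) = G"
    and tail: "\<And>x. x \<le> - x0 \<Longrightarrow> G x \<le> exp (- \<rho> * \<bar>x\<bar> powr b)"
    and th: "0 \<le> \<theta>" "\<theta> < \<rho>" "0 < b" "0 \<le> x0"
  shows "(\<integral>\<^sup>+ \<omega>. ennreal (exp (\<theta> * max 0 (- Y \<omega>) powr b)) \<partial>P)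
           \<le> ennreal (exp (\<rho> * x0 powr b) * exp \<theta> / (1 - exp (\<theta> - \<rho>)))"
proof (rule nn_integral_exp_le_of_tail)
  interpret prob_space P by fact
  fix m :: nat
  show "prob {\<omega> \<in> space P. real m \<le> max 0 (- Y \<omega>) powr b} \<le> exp (\<rho> * x0 powr b) * exp (- \<rho> * real m)"
  proof (cases "real m \<le> x0 powr b")
    case True
    have "1 \<le> exp (\<rho> * x0 powr b) * exp (- \<rho> * real m)"
      using True th by (simp add: exp_add[symmetric])
    then show ?thesis using prob_le_1 order_trans by blast
  next
    case False
    define t where "t = real m powr (1 / b)"
    have m: "0 < real m" using False th by (smt (verit) powr_ge_zero)
    have tb: "t powr b = real m" using m th by (simp add: t_def powr_powr)
    have "0 < t" using m by (simp add: t_def)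
    have "x0 < t"
    proof (rule ccontr)
      assume "\<not> x0 < t"
      then have "t powr b \<le> x0 powr b" using \<open>0 < t\<close> th by (intro powr_mono2) auto
      with False tb show False by simp
    qed
    have "{\<omega> \<in> space P. real m \<le> max 0 (- Y \<omega>) powr b} = {\<omega> \<in> space P. Y \<omega> \<le> - t}"
    proof -
      have "real m \<le> max 0 y powr b \<longleftrightarrow> t \<le> y" for y
      proof
        assume "real m \<le> max 0 y powr b"
        then have "t powr b \<le> max 0 y powr b" using tb by simp
        then have "t \<le> max 0 y"
          using \<open>0 < t\<close> th powr_less_mono2[of b "max 0 y" t] by fastforce
        then show "t \<le> y" using \<open>0 < t\<close> by simp
      next
        assume "t \<le> y"
        then have "t powr b \<le> y powr b" using \<open>0 < t\<close> th by (intro powr_mono2) auto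
        then show "real m \<le> max 0 y powr b" using tb \<open>t \<le> y\<close> \<open>0 < t\<close> by simp
      qed
      then show ?thesis by (simp only: le_minus_iff[of t])
    qed
    then have "prob {\<omega> \<in> space P. real m \<le> max 0 (- Y \<omega>) powr b} = G (- t)"
      using cdf_distr[OF assms(1) Y, of "- t"] G by simp
    also have "\<dots> \<le> exp (- \<rho> * \<bar>- t\<bar> powr b)"
      using \<open>x0 < t\<close> by (intro tail) simp
    also have "\<dots> = 1 * exp (- \<rho> * real m)" using tb \<open>0 < t\<close> by simp
    also have "\<dots> \<le> exp (\<rho> * x0 powr b) * exp (- \<rho> * real m)"
      using th by (intro mult_right_mono) auto
    finally show ?thesis .
  qed
qed (use assms in auto)

lemma iid_matrix_measurable:
  assumes "prob_space P" "iid_matrix P n G M" "i < n" "j < n"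
  shows "(\<lambda>\<omega>. M \<omega> i j) \<in> borel_measurable P"
  using assms(2-4) unfolding iid_matrix_def prob_space.indep_vars_def[OF assms(1)] by force

text \<open>
  The pairs \<open>(i, j)\<close>, \<open>(j, i)\<close> with \<open>j\<close> fixed and \<open>i \<noteq> j\<close> are disjoint for different \<open>i\<close>, so the factors are
  independent, although each involves two entries of the matrix.
\<close>

lemma nn_integral_column_prod_le:
  fixes f :: "real \<Rightarrow> ennreal"
  assumes P: "prob_space P" and iid: "iid_matrix P n G M" and [measurable]: "f \<in> borel_measurable borel"
    and C: "\<And>i j. i < n \<Longrightarrow> j < n \<Longrightarrow> (\<integral>\<^sup>+ \<omega>. f (M \<omega> i j) \<partial>P) \<le> C"
    and j: "j < n"
  shows "(\<integral>\<^sup>+ \<omega>. (\<Prod>i\<in>{..<n} - {j}. 1 + d * (f (M \<omega> i j) * f (M \<omega> j i))) \<partial>P)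
           \<le> (1 + d * (C * C)) ^ (n - 1)"
proof -
  interpret prob_space P by fact
  have ind: "indep_vars (\<lambda>_. borel) (\<lambda>(i, j) \<omega>. M \<omega> i j) ({..<n} \<times> {..<n})"
    using iid by (simp add: iid_matrix_def)
  note [measurable] = iid_matrix_measurable[OF P iid]
  define K where "K = (\<lambda>i. {(i, j), (j, i)})"
  define F where "F = (\<lambda>i (y :: nat \<times> nat \<Rightarrow> real). 1 + d * (f (y (i, j)) * f (y (j, i))))"
  have "indep_vars (\<lambda>i. PiM (K i) (\<lambda>_. borel))
      (\<lambda>i \<omega>. restrict (\<lambda>p. (case p of (i, j) \<Rightarrow> \<lambda>\<omega>. M \<omega> i j) \<omega>) (K i)) ({..<n} - {j})"
    using j by (intro indep_vars_restrict[OF ind]) (auto simp: K_def disjoint_family_on_def)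
  then have "indep_vars (\<lambda>_. borel)
      (\<lambda>i \<omega>. F i (restrict (\<lambda>p. (case p of (i, j) \<Rightarrow> \<lambda>\<omega>. M \<omega> i j) \<omega>) (K i))) ({..<n} - {j})"
  proof (rule indep_vars_compose2)
    fix i
    have [measurable]: "(\<lambda>y. y p) \<in> borel_measurable (PiM (K i) (\<lambda>_. borel))" if "p \<in> K i" for p
      using that by (intro measurable_component_singleton)
    have "(i, j) \<in> K i" "(j, i) \<in> K i" by (auto simp: K_def)
    then show "F i \<in> borel_measurable (PiM (K i) (\<lambda>_. borel))"
      unfolding F_def by measurable
  qed
  then have ind_column: "indep_vars (\<lambda>_. borel) (\<lambda>i \<omega>. 1 + d * (f (M \<omega> i j) * f (M \<omega> j i))) ({..<n} - {j})"
    by (simp add: F_def K_def)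
  have factor: "(\<integral>\<^sup>+ \<omega>. 1 + d * (f (M \<omega> i j) * f (M \<omega> j i)) \<partial>P) \<le> 1 + d * (C * C)"
    if i: "i \<in> {..<n} - {j}" for i
  proof -
    have ij: "i < n" "i \<noteq> j" using i by auto
    have "indep_vars (\<lambda>_. borel) (\<lambda>p \<omega>. f ((case p of (i, j) \<Rightarrow> \<lambda>\<omega>. M \<omega> i j) \<omega>)) (K i)"
      by (intro indep_vars_compose2[OF indep_vars_subset[OF ind]]) (use ij j in \<open>auto simp: K_def\<close>)
    then have "(\<integral>\<^sup>+ \<omega>. (\<Prod>p\<in>K i. f ((case p of (i, j) \<Rightarrow> \<lambda>\<omega>. M \<omega> i j) \<omega>)) \<partial>P)
        = (\<Prod>p\<in>K i. \<integral>\<^sup>+ \<omega>. f ((case p of (i, j) \<Rightarrow> \<lambda>\<omega>. M \<omega> i j) \<omega>) \<partial>P)"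
      by (intro indep_vars_nn_integral) (auto simp: K_def)
    then have "(\<integral>\<^sup>+ \<omega>. f (M \<omega> i j) * f (M \<omega> j i) \<partial>P)
        = (\<integral>\<^sup>+ \<omega>. f (M \<omega> i j) \<partial>P) * (\<integral>\<^sup>+ \<omega>. f (M \<omega> j i) \<partial>P)"
      using ij by (simp add: K_def)
    also have "\<dots> \<le> C * C"
      using ij j by (intro mult_mono C) auto
    finally have "(\<integral>\<^sup>+ \<omega>. f (M \<omega> i j) * f (M \<omega> j i) \<partial>P) \<le> C * C" .
    then show ?thesis
      using ij j by (simp add: nn_integral_add nn_integral_cmult emeasure_space_1 mult_left_mono)
  qed
  have "(\<integral>\<^sup>+ \<omega>. (\<Prod>i\<in>{..<n} - {j}. 1 + d * (f (M \<omega> i j) * f (M \<omega> j i))) \<partial>P)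
      = (\<Prod>i\<in>{..<n} - {j}. \<integral>\<^sup>+ \<omega>. 1 + d * (f (M \<omega> i j) * f (M \<omega> j i)) \<partial>P)"
    by (intro indep_vars_nn_integral ind_column) auto
  also have "\<dots> \<le> (\<Prod>i\<in>{..<n} - {j}. 1 + d * (C * C))"
    by (intro prod_mono_ennreal factor)
  also have "\<dots> = (1 + d * (C * C)) ^ (n - 1)"
    using j by simp
  finally show ?thesis .
qed

lemma prob_all_diag_gt:
  assumes P: "prob_space P" and iid: "iid_matrix P n G M" and "0 < n"
  shows "measure P {\<omega> \<in> space P. \<forall>i<n. x < M \<omega> i i} \<le> exp (- (real n * G x))"
proof -
  interpret prob_space P by fact
  have ind: "indep_vars (\<lambda>_. borel) (\<lambda>(i, j) \<omega>. M \<omega> i j) ({..<n} \<times> {..<n})"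
    using iid by (simp add: iid_matrix_def)
  note [measurable] = iid_matrix_measurable[OF P iid]
  let ?D = "(\<lambda>i. (i, i)) ` {..<n}"
  have one: "prob {\<omega> \<in> space P. x < M \<omega> i i} = 1 - G x" if "i < n" for i
  proof -
    have "prob {\<omega> \<in> space P. \<not> M \<omega> i i \<le> x} = 1 - prob {\<omega> \<in> space P. M \<omega> i i \<le> x}"
      using that by (intro prob_neg) measurable
    moreover have "G x = prob {\<omega> \<in> space P. M \<omega> i i \<le> x}"
      using cdf_distr[OF P, of "\<lambda>\<omega>. M \<omega> i i" x] iid that by (auto simp: iid_matrix_def)
    ultimately show ?thesis by (simp add: not_le)
  qed
  have "prob (\<Inter>p\<in>?D. (case p of (i, j) \<Rightarrow> \<lambda>\<omega>. M \<omega> i j) -` {x<..} \<inter> space P)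
      = (\<Prod>p\<in>?D. prob ((case p of (i, j) \<Rightarrow> \<lambda>\<omega>. M \<omega> i j) -` {x<..} \<inter> space P))"
    using \<open>0 < n\<close> by (intro indep_varsD[OF ind]) auto
  also have "\<dots> = (\<Prod>i<n. prob {\<omega> \<in> space P. x < M \<omega> i i})"
    by (subst prod.reindex) (auto simp: inj_on_def vimage_def Int_def conj_commute)
  also have "\<dots> = (1 - G x) ^ n"
    by (simp add: one)
  also have "(\<Inter>p\<in>?D. (case p of (i, j) \<Rightarrow> \<lambda>\<omega>. M \<omega> i j) -` {x<..} \<inter> space P)
      = {\<omega> \<in> space P. \<forall>i<n. x < M \<omega> i i}"
    using \<open>0 < n\<close> by auto
  finally have "prob {\<omega> \<in> space P. \<forall>i<n. x < M \<omega> i i} = (1 - G x) ^ n" .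
  also have "\<dots> \<le> exp (- G x) ^ n"
  proof (rule power_mono)
    show "1 - G x \<le> exp (- G x)"
      using exp_ge_add_one_self[of "- G x"] by simp
    show "0 \<le> 1 - G x"
      unfolding one[OF \<open>0 < n\<close>, symmetric] by (rule measure_nonneg)
  qed
  also have "\<dots> = exp (- (real n * G x))"
    by (simp add: exp_of_nat_mult[symmetric])
  finally show ?thesis .
qed

section \<open>Asymptotic comparisons\<close>

text \<open>
  For lower tails of the assumed form, the constant, the power and the error term are absorbed by a change
  of the factor 1 in front of \<open>\<bar>x\<bar> powr b\<close>. This precision suffices in all that follows.
\<close>

lemma eventually_exp_between:
  fixes G rG :: "real \<Rightarrow> real"
  assumes "0 < b" "0 < c" "0 < \<kappa>"
    and r: "rG \<in> O[at_bot](\<lambda>x. \<bar>x\<bar> powr (- \<kappa>))"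
    and G: "\<forall>\<^sub>F x in at_bot. G x = (c + rG x) * \<bar>x\<bar> powr a * exp (- (\<bar>x\<bar> powr b))"
    and "\<rho> < 1" "1 < \<rho>'"
  shows "\<forall>\<^sub>F x in at_bot. exp (- \<rho>' * \<bar>x\<bar> powr b) \<le> G x \<and> G x \<le> exp (- \<rho> * \<bar>x\<bar> powr b)"
proof -
  have "((\<lambda>x. \<bar>x\<bar> powr (- \<kappa>)) \<longlongrightarrow> 0) (at_bot :: real filter)"
    using \<open>0 < \<kappa>\<close> by real_asymp
  then have "(\<lambda>x. \<bar>x\<bar> powr (- \<kappa>)) \<in> o[at_bot](\<lambda>_. 1 :: real)"
    by (intro smalloI_tendsto) auto
  with r have "rG \<in> o[at_bot](\<lambda>_. 1)"
    by (rule landau_o.big_small_trans)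
  then have "(rG \<longlongrightarrow> 0) at_bot"
    using smalloD_tendsto by fastforce
  from tendsto_add[OF tendsto_const[of c] this] have lim: "((\<lambda>x. c + rG x) \<longlongrightarrow> c) at_bot"
    by simp
  have "\<forall>\<^sub>F x in at_bot. c / 2 < c + rG x" "\<forall>\<^sub>F x in at_bot. c + rG x < 2 * c"
    by (rule order_tendstoD[OF lim], use \<open>0 < c\<close> in simp)+
  moreover have "\<forall>\<^sub>F x in at_bot. 2 * c * \<bar>x\<bar> powr a * exp (- (1 - \<rho>) * \<bar>x\<bar> powr b) \<le> 1"
  proof -
    have "1 - \<rho> > 0" using assms by simp
    then show ?thesis using assms by real_asymp
  qed
  moreover have "\<forall>\<^sub>F x in at_bot. 1 \<le> c / 2 * \<bar>x\<bar> powr a * exp ((\<rho>' - 1) * \<bar>x\<bar> powr b)"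
  proof -
    have "\<rho>' - 1 > 0" using assms by simp
    then show ?thesis using assms by real_asymp
  qed
  ultimately show ?thesis
    using G
  proof eventually_elim
    case (elim x)
    let ?p = "\<bar>x\<bar> powr a" and ?q = "\<bar>x\<bar> powr b"
    have "exp (- \<rho>' * ?q) = 1 * exp (- \<rho>' * ?q)" by simp
    also have "\<dots> \<le> (c / 2 * ?p * exp ((\<rho>' - 1) * ?q)) * exp (- \<rho>' * ?q)"
      using elim by (intro mult_right_mono) auto
    also have "\<dots> = c / 2 * ?p * exp (- ?q)"
      by (simp add: mult.assoc exp_add[symmetric] algebra_simps)
    also have "\<dots> \<le> G x"
      unfolding elim using elim by (intro mult_right_mono) auto
    finally have lower: "exp (- \<rho>' * ?q) \<le> G x" .
    have "G x \<le> 2 * c * ?p * exp (- ?q)"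
      unfolding elim using elim by (intro mult_right_mono) auto
    also have "\<dots> = (2 * c * ?p * exp (- (1 - \<rho>) * ?q)) * exp (- \<rho> * ?q)"
      by (simp add: mult.assoc exp_add[symmetric] algebra_simps)
    also have "\<dots> \<le> 1 * exp (- \<rho> * ?q)"
      using elim by (intro mult_right_mono) auto
    finally show ?case using lower by simp
  qed
qed

lemma eventually_two_exp_le:
  fixes \<delta> \<eta> e e' K :: real
  assumes "0 < \<delta>" "0 < \<eta>" "e < e'" "1 < e'"
  shows "\<forall>\<^sub>F n :: nat in sequentially.
    exp (- (real n powr \<delta>)) + exp (ln (real n) + K - \<eta> * ln (real n) powr e') \<le> exp (- (ln (real n) powr e))"
proof -
  have "\<forall>\<^sub>F n :: nat in sequentially. ln (real n) powr e + ln 2 \<le> real n powr \<delta>"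
    using assms by real_asymp
  moreover have "\<forall>\<^sub>F n :: nat in sequentially. ln (real n) powr e + ln 2 + ln (real n) + K \<le> \<eta> * ln (real n) powr e'"
  proof -
    have "\<forall>\<^sub>F s in at_top. s powr e \<le> \<eta> / 3 * s powr e'"
      using assms by real_asymp
    moreover have "\<forall>\<^sub>F s in at_top. s \<le> \<eta> / 3 * s powr e'"
      using assms by real_asymp
    moreover have "\<forall>\<^sub>F s in at_top. ln 2 + K \<le> \<eta> / 3 * s powr e'"
      using assms by real_asymp
    ultimately have "\<forall>\<^sub>F s in at_top. s powr e + ln 2 + s + K \<le> \<eta> * s powr e'"
      by eventually_elim simp
    moreover have "filterlim (\<lambda>n. ln (real n)) at_top sequentially"
      by real_asymp
    ultimately show ?thesis
      by (rule eventually_compose_filterlim)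
  qed
  ultimately show ?thesis
  proof eventually_elim
    case (elim n)
    have "exp (- (real n powr \<delta>)) \<le> exp (- (ln (real n) powr e) - ln 2)"
      using elim by simp
    moreover have "exp (ln (real n) + K - \<eta> * ln (real n) powr e') \<le> exp (- (ln (real n) powr e) - ln 2)"
      using elim by simp
    moreover have "exp (- (ln (real n) powr e) - ln 2) = exp (- (ln (real n) powr e)) / 2"
      by (simp add: exp_diff)
    ultimately show ?case by simp
  qed
qed

section \<open>Bounding the probability of a given support size\<close>

text \<open>
  The deterministic core. A diagonal entry of at most \<open>- 4 * L / 5\<close> and a support of size \<open>k + 1\<close> force
  the product over some column to be large. Each factor depends on the matrix only through the negative parts of
  the two entries \<open>A i j\<close> and \<open>A j i\<close>, so that its expectation is within reach. With
  \<open>v i\<close> twice the negative part of the symmetrized entry, the average of the \<open>v i\<close> over the \<open>k\<close>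
  indices is at least \<open>8 * L / 5\<close>, and \<open>6 * L / 5\<close> is the threshold for large terms.
\<close>

lemma support_size_imp_large_column_prod:
  fixes L :: real
  assumes sol: "StQP_solution n (sym_part A) x" and supp: "support_size n x = k + 1"
    and i0: "i0 < n" "A i0 i0 \<le> - (4 / 5 * L)"
    and b: "0 < b" "b \<le> 1" and L: "L = ln (real n) powr (1 / b)" "1 \<le> n"
    and th: "\<theta>' = \<theta> + (5 / 6) powr b" "0 \<le> \<theta>"
  obtains j where "j < n"
    "exp (\<theta> * (2 / 5 * real k) powr b * ln (real n))
      \<le> (\<Prod>i\<in>{..<n} - {j}. 1 + 1 / real n *
            (exp (\<theta>' * max 0 (- A i j) powr b) * exp (\<theta>' * max 0 (- A j i) powr b)))"
proof -
  have ln: "0 \<le> ln (real n)" using L by simp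
  have L0: "0 \<le> L" and Lb: "L powr b = ln (real n)"
    using L b ln by (simp_all add: powr_powr)
  obtain j S where j: "j < n" and S: "S \<subseteq> {..<n} - {j}" "card S = k"
    and light: "\<And>i. i < n \<Longrightarrow> (\<Sum>i\<in>S. sym_part A i j) \<le> real k * sym_part A i i"
  proof -
    have "sym_part A i j = sym_part A j i" for i j
      by (simp add: sym_part_def add.commute)
    from StQP_solution_light_column[OF sol this supp] that show ?thesis by metis
  qed
  define v where "v = (\<lambda>i. max 0 (- (A i j + A j i)))"
  define \<tau> where "\<tau> = (6 / 5) powr b * ln (real n)"
  have "(\<Sum>i\<in>S. sym_part A i j) \<le> real k * A i0 i0"
    using light[OF i0(1)] by (simp add: sym_part_def)
  also have "\<dots> \<le> real k * (- (4 / 5 * L))"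
    using i0 by (intro mult_left_mono) auto
  finally have sum_S: "(\<Sum>i\<in>S. sym_part A i j) \<le> real k * (- (4 / 5 * L))" .
  have "real k * (2 / 5 * L + 6 / 5 * L) = - 2 * (real k * (- (4 / 5 * L)))"
    by (simp add: field_simps)
  also have "\<dots> \<le> - 2 * (\<Sum>i\<in>S. sym_part A i j)"
    using sum_S by linarith
  also have "\<dots> = (\<Sum>i\<in>S. - (A i j + A j i))"
    unfolding sum_distrib_left by (intro sum.cong) (simp_all add: sym_part_def)
  also have "\<dots> \<le> (\<Sum>i\<in>S. v i)"
    by (intro sum_mono) (simp add: v_def)
  finally have large: "real (card S) * (2 / 5 * L + 6 / 5 * L) \<le> (\<Sum>i\<in>S. v i)"
    unfolding S(2) .
  have "(real (card S) * (2 / 5 * L)) powr b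
      \<le> (\<Sum>i\<in>{..<n} - {j}. if 6 / 5 * L < v i then v i powr b else 0)"
    by (rule sum_large_powr_ge[OF _ S(1) _ b _ _ large]) (use L0 in \<open>auto simp: v_def\<close>)
  also have "\<dots> = (\<Sum>i\<in>{..<n} - {j}. if \<tau> < v i powr b then v i powr b else 0)"
  proof -
    have "6 / 5 * L < v i \<longleftrightarrow> \<tau> < v i powr b" for i
    proof -
      have "\<tau> = (6 / 5 * L) powr b"
        using L0 Lb by (subst powr_mult) (auto simp: \<tau>_def)
      moreover have "0 \<le> v i" "0 \<le> 6 / 5 * L" using L0 by (auto simp: v_def)
      ultimately show ?thesis
        using b powr_less_mono2[of b "6 / 5 * L" "v i"] powr_mono2[of b "v i" "6 / 5 * L"] by fastforce
    qed
    then show ?thesis by simp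
  qed
  also have "(real (card S) * (2 / 5 * L)) powr b = (2 / 5 * real k) powr b * ln (real n)"
    unfolding S(2) Lb[symmetric] using L0 by (subst powr_mult[symmetric]) (auto simp: ac_simps)
  finally have "exp (\<theta> * ((2 / 5 * real k) powr b * ln (real n)))
      \<le> exp (\<theta> * (\<Sum>i\<in>{..<n} - {j}. if \<tau> < v i powr b then v i powr b else 0))"
    using th by (simp add: mult_left_mono)
  also have "\<dots> \<le> (\<Prod>i\<in>{..<n} - {j}. 1 + exp (- (\<theta>' - \<theta>) * \<tau>) * exp (\<theta>' * v i powr b))"
    using th ln by (intro exp_sum_large_le_prod) (auto simp: \<tau>_def)
  \<comment> \<open>The difference \<open>\<theta>' - \<theta>\<close> is chosen for this identity.\<close>
  also have "exp (- (\<theta>' - \<theta>) * \<tau>) = 1 / real n"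
  proof -
    have "(5 / 6) powr b * (6 / 5) powr b = (1 :: real)"
      by (simp add: powr_mult[symmetric])
    then have "(\<theta>' - \<theta>) * \<tau> = ln (real n)"
      using th by (simp add: \<tau>_def mult.assoc[symmetric])
    then have "- (\<theta>' - \<theta>) * \<tau> = - ln (real n)"
      by (simp only: mult_minus_left)
    then show ?thesis using L by (simp add: exp_minus inverse_eq_divide)
  qed
  also have "(\<Prod>i\<in>{..<n} - {j}. 1 + 1 / real n * exp (\<theta>' * v i powr b))
      \<le> (\<Prod>i\<in>{..<n} - {j}. 1 + 1 / real n *
            (exp (\<theta>' * max 0 (- A i j) powr b) * exp (\<theta>' * max 0 (- A j i) powr b)))"
  proof (intro prod_mono conjI)
    fix i
    have "v i powr b \<le> (max 0 (- A i j) + max 0 (- A j i)) powr b"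
      using b by (intro powr_mono2) (auto simp: v_def)
    also have "\<dots> \<le> max 0 (- A i j) powr b + max 0 (- A j i) powr b"
      using b by (intro powr_add_le_add_powr) auto
    finally have "\<theta>' * v i powr b \<le> \<theta>' * (max 0 (- A i j) powr b + max 0 (- A j i) powr b)"
      using th by (intro mult_left_mono) auto
    then have "exp (\<theta>' * v i powr b) \<le> exp (\<theta>' * max 0 (- A i j) powr b) * exp (\<theta>' * max 0 (- A j i) powr b)"
      by (simp add: mult_exp_exp algebra_simps)
    then show "1 + 1 / real n * exp (\<theta>' * v i powr b)
        \<le> 1 + 1 / real n * (exp (\<theta>' * max 0 (- A i j) powr b) * exp (\<theta>' * max 0 (- A j i) powr b))"
      by (intro add_left_mono mult_left_mono) auto
  qed simp
  finally show ?thesis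
    using j by (intro that[of j]) (simp_all add: mult.assoc)
qed

text \<open>
  Markov's inequality; the expectation of the product is at most \<open>(1 + C\<^sup>2 / n) ^ n \<le> exp (C\<^sup>2)\<close>.
\<close>

lemma prob_column_prod_ge:
  fixes f :: "real \<Rightarrow> real"
  assumes P: "prob_space P" and iid: "iid_matrix P n G M" and [measurable]: "f \<in> borel_measurable borel"
    and f: "\<And>y. 0 \<le> f y" and C: "0 \<le> C"
    "\<And>i j. i < n \<Longrightarrow> j < n \<Longrightarrow> (\<integral>\<^sup>+ \<omega>. ennreal (f (M \<omega> i j)) \<partial>P) \<le> ennreal C"
    and j: "j < n"
  shows "measure P {\<omega> \<in> space P. exp s \<le> (\<Prod>i\<in>{..<n} - {j}. 1 + 1 / real n * (f (M \<omega> i j) * f (M \<omega> j i)))}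
           \<le> exp (C\<^sup>2 - s)"
proof -
  interpret prob_space P by fact
  note [measurable] = iid_matrix_measurable[OF P iid]
  define g where "g = (\<lambda>\<omega>. \<Prod>i\<in>{..<n} - {j}. 1 + 1 / real n * (f (M \<omega> i j) * f (M \<omega> j i)))"
  have [measurable]: "g \<in> borel_measurable P" using j unfolding g_def by measurable
  have g: "ennreal (g \<omega>) = (\<Prod>i\<in>{..<n} - {j}. 1 + ennreal (1 / real n) * (ennreal (f (M \<omega> i j)) * ennreal (f (M \<omega> j i))))" for \<omega>
    unfolding g_def using f
    by (subst prod_ennreal[symmetric]) (auto simp: ennreal_mult simp del: times_divide_eq_left times_divide_eq_right)
  have "emeasure P {\<omega> \<in> space P. 1 \<le> ennreal (exp (- s)) * ennreal (g \<omega>)}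
      \<le> ennreal (exp (- s)) * (\<integral>\<^sup>+ \<omega>. ennreal (g \<omega>) * indicator (space P) \<omega> \<partial>P)"
    by (rule nn_integral_Markov_inequality) auto
  also have "(\<integral>\<^sup>+ \<omega>. ennreal (g \<omega>) * indicator (space P) \<omega> \<partial>P) = (\<integral>\<^sup>+ \<omega>. ennreal (g \<omega>) \<partial>P)"
    by (intro nn_integral_cong) simp
  also have "\<dots> \<le> (1 + ennreal (1 / real n) * (ennreal C * ennreal C)) ^ (n - 1)"
    unfolding g by (rule nn_integral_column_prod_le[OF P iid]) (use C j in auto)
  also have "\<dots> = ennreal ((1 + C\<^sup>2 / real n) ^ (n - 1))"
    using C by (simp add: ennreal_mult[symmetric] ennreal_power[symmetric] power2_eq_square flip: ennreal_1 ennreal_plus)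
  also have "(1 + C\<^sup>2 / real n) ^ (n - 1) \<le> exp (C\<^sup>2)"
  proof -
    have "(1 + C\<^sup>2 / real n) ^ (n - 1) \<le> (1 + C\<^sup>2 / real n) ^ n"
      by (intro power_increasing) auto
    also have "\<dots> \<le> exp (C\<^sup>2 / real n) ^ n"
      by (intro power_mono exp_ge_add_one_self) (auto intro: add_nonneg_nonneg)
    also have "\<dots> = exp (C\<^sup>2)" using j by (simp add: exp_of_nat_mult[symmetric])
    finally show ?thesis .
  qed
  finally have "emeasure P {\<omega> \<in> space P. 1 \<le> ennreal (exp (- s)) * ennreal (g \<omega>)} \<le> ennreal (exp (- s)) * ennreal (exp (C\<^sup>2))"
    by (simp add: ennreal_leI mult_left_mono)
  also have "\<dots> = ennreal (exp (C\<^sup>2 - s))"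
    by (simp add: ennreal_mult[symmetric] mult_exp_exp)
  also have "{\<omega> \<in> space P. 1 \<le> ennreal (exp (- s)) * ennreal (g \<omega>)} = {\<omega> \<in> space P. exp s \<le> g \<omega>}"
  proof -
    have "1 \<le> ennreal (exp (- s)) * ennreal (g \<omega>) \<longleftrightarrow> exp s \<le> g \<omega>" for \<omega>
    proof -
      have "ennreal (exp (- s)) * ennreal (g \<omega>) = ennreal (g \<omega> / exp s)"
        using ennreal_mult'[of "exp (- s)" "g \<omega>"] by (simp add: exp_minus divide_inverse mult.commute)
      then show ?thesis by (simp add: ennreal_ge_1)
    qed
    then show ?thesis by simp
  qed
  finally show ?thesis
    by (simp add: emeasure_eq_measure g_def)
qed

text \<open>
  Either all diagonal entries exceed \<open>- 4 * L / 5\<close>, or one of the \<open>n\<close> columns has a product of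
  the size that the previous lemma makes unlikely. The two summands bound these two cases.
\<close>

lemma prob_support_size_le:
  assumes P: "prob_space P" and iid: "iid_matrix P n G M"
    and sol: "random_StQP_solution P n (\<lambda>\<omega>. sym_part (M \<omega>)) X"
    and b: "0 < b" "b \<le> 1" and n: "1 \<le> n"
    and th: "\<theta>' = \<theta> + (5 / 6) powr b" "0 \<le> \<theta>"
    and C: "0 \<le> C" "\<And>i j. i < n \<Longrightarrow> j < n \<Longrightarrow>
       (\<integral>\<^sup>+ \<omega>. ennreal (exp (\<theta>' * max 0 (- M \<omega> i j) powr b)) \<partial>P) \<le> ennreal C"
  shows "measure P {\<omega> \<in> space P. support_size n (X \<omega>) = k + 1}
     \<le> exp (- (real n * G (- (4 / 5 * ln (real n) powr (1 / b)))))
       + real n * exp (C\<^sup>2 - \<theta> * (2 / 5 * real k) powr b * ln (real n))"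
proof -
  interpret prob_space P by fact
  note [measurable] = iid_matrix_measurable[OF P iid]
  define L where "L = ln (real n) powr (1 / b)"
  define f where "f = (\<lambda>y. exp (\<theta>' * max 0 (- y) powr b))"
  have [measurable]: "f \<in> borel_measurable borel" unfolding f_def by measurable
  define D where "D = {\<omega> \<in> space P. \<forall>i<n. - (4 / 5 * L) < M \<omega> i i}"
  define s where "s = \<theta> * (2 / 5 * real k) powr b * ln (real n)"
  define E where "E = (\<lambda>j. {\<omega> \<in> space P. exp s \<le> (\<Prod>i\<in>{..<n} - {j}. 1 + 1 / real n * (f (M \<omega> i j) * f (M \<omega> j i)))})"
  have D[measurable]: "D \<in> sets P" unfolding D_def by measurable
  have E[measurable]: "E j \<in> sets P" if "j < n" for j using that unfolding E_def by measurable
  have "{\<omega> \<in> space P. support_size n (X \<omega>) = k + 1} \<subseteq> D \<union> (\<Union>j<n. E j)"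
  proof (intro subsetI UnCI)
    fix \<omega> assume \<omega>: "\<omega> \<in> {\<omega> \<in> space P. support_size n (X \<omega>) = k + 1}" and "\<omega> \<notin> (\<Union>j<n. E j)"
    then have notE: "\<And>j. j < n \<Longrightarrow> \<omega> \<notin> E j" by auto
    have min: "StQP_solution n (sym_part (M \<omega>)) (X \<omega>)"
      using sol \<omega> by (auto simp: random_StQP_solution_def)
    show "\<omega> \<in> D"
    proof (rule ccontr)
      assume "\<omega> \<notin> D"
      then obtain i0 where i0: "i0 < n" "M \<omega> i0 i0 \<le> - (4 / 5 * L)"
        using \<omega> by (auto simp: D_def not_less)
      from \<omega> have supp: "support_size n (X \<omega>) = k + 1" by simp
      from support_size_imp_large_column_prod[OF min supp i0 b L_def n th] obtain j where "j < n"
        "exp s \<le> (\<Prod>i\<in>{..<n} - {j}. 1 + 1 / real n * (f (M \<omega> i j) * f (M \<omega> j i)))"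
        unfolding s_def f_def by blast
      with notE \<omega> show False by (auto simp: E_def)
    qed
  qed
  then have "prob {\<omega> \<in> space P. support_size n (X \<omega>) = k + 1} \<le> prob (D \<union> (\<Union>j<n. E j))"
    by (intro finite_measure_mono) auto
  also have "\<dots> \<le> prob D + prob (\<Union>j<n. E j)"
    by (intro measure_Un_le) auto
  also have "prob (\<Union>j<n. E j) \<le> (\<Sum>j<n. prob (E j))"
    by (intro finite_measure_subadditive_finite) auto
  also have "\<dots> \<le> (\<Sum>j<n. exp (C\<^sup>2 - s))"
    unfolding E_def
    by (intro sum_mono prob_column_prod_ge[OF P iid]) (use C in \<open>auto simp: f_def\<close>)
  also have "prob D \<le> exp (- (real n * G (- (4 / 5 * L))))"
    unfolding D_def using n by (intro prob_all_diag_gt[OF P iid]) auto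
  finally show ?thesis by (simp add: s_def L_def)
qed

theorem theorem3p11:
  fixes G g rG rg :: "real \<Rightarrow> real"
    and a b c \<kappa> \<sigma> \<alpha> d' :: real
  assumes "continuous_on UNIV G"
    and "0 < b" and "0 < c" and "0 < \<kappa>"
    and "rG \<in> O[at_bot](\<lambda>x. \<bar>x\<bar> powr (- \<kappa>))"
    and "\<forall>\<^sub>F x in at_bot. G x = (c + rG x) * \<bar>x\<bar> powr a * exp (- (\<bar>x\<bar> powr b))"
    and "\<forall>\<^sub>F x in at_bot. (G has_real_derivative g x) (at x)"
    and "rg \<in> O[at_bot](\<lambda>x. \<bar>x\<bar> powr (- \<kappa>))"
    and "\<forall>\<^sub>F x in at_bot.
           g x = (c * b + rg x) * \<bar>x\<bar> powr (a + b - 1) * exp (- (\<bar>x\<bar> powr b))"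
    and "b \<le> 1" and "a > - 1"
    and "\<sigma> > sigma_crit (a_prime a b) b"
    and "\<alpha> > exp 1 * sqrt 2"
    and "d' < b * (\<sigma> - sigma_crit (a_prime a b) b) / 2"
  shows "\<forall>\<^sub>F n in sequentially. \<forall>k.
           \<lfloor>ln (real n) powr \<sigma>\<rfloor> \<le> int k \<and> int k \<le> \<lceil>\<alpha> * real n powr (1 / 2)\<rceil> \<longrightarrow>
           (\<forall>(P :: 'w measure) M X.
              prob_space P \<and> iid_matrix P n G M \<and>
              random_StQP_solution P n (\<lambda>\<omega>. sym_part (M \<omega>)) X \<longrightarrow>
              \<P>(\<omega> in P. support_size n (X \<omega>) = k + 1)
                \<le> exp (- (ln (real n) powr (1 + d'))))"
proof -
  note b = \<open>0 < b\<close> \<open>b \<le> 1\<close>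
  have crit: "1 \<le> sigma_crit (a_prime a b) b"
    using b by (auto simp: sigma_crit_def)
  with assms have \<sigma>: "1 < \<sigma>" by simp
  have exponents: "1 + d' < 1 + \<sigma> * b" "1 < 1 + \<sigma> * b"
  proof -
    have "b * (\<sigma> - sigma_crit (a_prime a b) b) / 2 \<le> b * \<sigma> / 2"
      using b crit by (intro divide_right_mono mult_left_mono) auto
    also have "\<dots> < \<sigma> * b" using b \<sigma> by simp
    finally show "1 + d' < 1 + \<sigma> * b" using assms(14) by linarith
    show "1 < 1 + \<sigma> * b" using b \<sigma> by simp
  qed
  have small: "(5 / 6) powr b < (1 :: real)" and big: "1 < (5 / 4 :: real) powr b"
    using b powr_less_mono2[of b "5 / 6" 1] powr_less_mono2[of b 1 "5 / 4"] by auto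
  \<comment> \<open>The threshold \<open>6 * L / 5\<close> requires \<open>\<theta>' - \<theta> = (5 / 6) powr b\<close>, which leaves room
    for \<open>0 < \<theta> < \<theta>' < \<rho> < 1\<close> as \<open>(5 / 6) powr b < 1\<close>.\<close>
  define \<theta>' where "\<theta>' = ((5 / 6) powr b + 1) / 2"
  define \<theta> where "\<theta> = (1 - (5 / 6) powr b) / 2"
  define \<rho> where "\<rho> = (\<theta>' + 1) / 2"
  have th: "\<theta>' = \<theta> + (5 / 6) powr b" "0 < \<theta>" "0 \<le> \<theta>'" "\<theta>' < \<rho>" "\<rho> < 1"
    using small by (auto simp: \<theta>'_def \<theta>_def \<rho>_def field_simps)
  \<comment> \<open>The lower tail rate \<open>\<rho>'\<close> is so close to 1 that \<open>n * exp (- \<rho>' * (4 * L / 5) powr b)\<close> is a positive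
    power of \<open>n\<close>.\<close>
  obtain \<rho>' where \<rho>': "1 < \<rho>'" "\<rho>' < (5 / 4) powr b" using dense[OF big] by auto
  define \<delta> where "\<delta> = 1 - \<rho>' * (4 / 5) powr b"
  have "\<delta> > 0"
  proof -
    have "(5 / 4) powr b * (4 / 5) powr b = (1 :: real)" by (simp add: powr_mult[symmetric])
    moreover have "\<rho>' * (4 / 5) powr b < (5 / 4) powr b * (4 / 5) powr b"
      using \<rho>' by (intro mult_strict_right_mono) auto
    ultimately show ?thesis by (simp add: \<delta>_def)
  qed
  obtain x0 where x0: "\<And>x. x \<le> x0 \<Longrightarrow>
      exp (- \<rho>' * \<bar>x\<bar> powr b) \<le> G x \<and> G x \<le> exp (- \<rho> * \<bar>x\<bar> powr b)"
    using eventually_exp_between[OF assms(2-6) th(5) \<rho>'(1)] unfolding eventually_at_bot_linorder by auto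
  define y0 where "y0 = max 0 (- x0)"
  define C where "C = exp (\<rho> * y0 powr b) * exp \<theta>' / (1 - exp (\<theta>' - \<rho>))"
  have C: "0 \<le> C" using th by (simp add: C_def)
  define \<eta> where "\<eta> = \<theta> * (1 / 5) powr b"
  have "0 < \<eta>" using th by (simp add: \<eta>_def)
  have "\<forall>\<^sub>F n :: nat in sequentially. y0 \<le> 4 / 5 * ln (real n) powr (1 / b)"
    using b by real_asymp
  moreover have "\<forall>\<^sub>F n :: nat in sequentially. 2 \<le> ln (real n) powr \<sigma>"
    using \<sigma> by real_asymp
  moreover note eventually_two_exp_le[OF \<open>0 < \<delta>\<close> \<open>0 < \<eta>\<close> exponents, of "C\<^sup>2"] eventually_ge_at_top[of 2]
  ultimately show ?thesis
  proof eventually_elim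
    case (elim n)
    have n: "1 \<le> n" "0 < ln (real n)" using elim(4) by auto
    show ?case
    proof (intro allI impI, elim conjE)
      fix k and P :: "'w measure" and M X
      assume k: "\<lfloor>ln (real n) powr \<sigma>\<rfloor> \<le> int k" and P: "prob_space P" and iid: "iid_matrix P n G M"
        and sol: "random_StQP_solution P n (\<lambda>\<omega>. sym_part (M \<omega>)) X"
      have moment: "(\<integral>\<^sup>+ \<omega>. ennreal (exp (\<theta>' * max 0 (- M \<omega> i j) powr b)) \<partial>P) \<le> ennreal C"
        if "i < n" "j < n" for i j
        unfolding C_def
      proof (rule nn_integral_exp_neg_part_powr_le[OF P iid_matrix_measurable[OF P iid that]])
        show "cdf (distr P borel (\<lambda>\<omega>. M \<omega> i j)) = G" using iid that by (auto simp: iid_matrix_def)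
        show "G x \<le> exp (- \<rho> * \<bar>x\<bar> powr b)" if "x \<le> - y0" for x
          using that x0[of x] by (simp add: y0_def)
      qed (use th b in \<open>auto simp: y0_def\<close>)
      let ?L = "ln (real n) powr (1 / b)"
      have "real n powr \<delta> \<le> real n * G (- (4 / 5 * ?L))"
      proof -
        have "(4 / 5 * ?L) powr b = (4 / 5) powr b * ln (real n)"
          using b n by (subst powr_mult) (auto simp: powr_powr)
        then have "real n powr \<delta> = real n * exp (- \<rho>' * \<bar>- (4 / 5 * ?L)\<bar> powr b)"
          using n by (simp add: powr_def \<delta>_def left_diff_distrib exp_diff exp_minus field_simps)
        also have "\<dots> \<le> real n * G (- (4 / 5 * ?L))"
          using x0[of "- (4 / 5 * ?L)"] elim(1) by (intro mult_left_mono) (auto simp: y0_def)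
        finally show ?thesis .
      qed
      moreover have "\<eta> * ln (real n) powr (1 + \<sigma> * b) \<le> \<theta> * (2 / 5 * real k) powr b * ln (real n)"
      proof -
        \<comment> \<open>The loss of 1 in the floor is at most half of \<open>(ln n) powr \<sigma> \<ge> 2\<close>.\<close>
        have "ln (real n) powr \<sigma> \<le> 2 * real k" using k elim(2) by linarith
        then have "(1 / 5 * ln (real n) powr \<sigma>) powr b \<le> (2 / 5 * real k) powr b"
          using b by (intro powr_mono2) auto
        moreover have "(1 / 5 * ln (real n) powr \<sigma>) powr b = (1 / 5) powr b * ln (real n) powr (\<sigma> * b)"
          by (subst powr_mult) (auto simp: powr_powr)
        ultimately have "\<theta> * ((1 / 5) powr b * ln (real n) powr (\<sigma> * b)) * ln (real n)
            \<le> \<theta> * (2 / 5 * real k) powr b * ln (real n)"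
          using th n by (intro mult_right_mono mult_left_mono) auto
        then show ?thesis using n by (simp add: \<eta>_def powr_add ac_simps)
      qed
      ultimately have "exp (- (real n * G (- (4 / 5 * ?L))))
          + exp (ln (real n) + (C\<^sup>2 - \<theta> * (2 / 5 * real k) powr b * ln (real n)))
          \<le> exp (- (real n powr \<delta>)) + exp (ln (real n) + C\<^sup>2 - \<eta> * ln (real n) powr (1 + \<sigma> * b))"
        by (intro add_mono) auto
      also have "\<dots> \<le> exp (- (ln (real n) powr (1 + d')))"
        by (rule elim(3))
      finally show "\<P>(\<omega> in P. support_size n (X \<omega>) = k + 1) \<le> exp (- (ln (real n) powr (1 + d')))"
        using prob_support_size_le[OF P iid sol b n(1) th(1) less_imp_le[OF th(2)] C moment, of k] n
        by (simp add: exp_add)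
    qed
  qed
qed

end
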